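(* Let $n\ge 8$ be an integer. Then $$ex(n,\mathscr{F}_{n-4})=\frac{n(n-1)}{2}-4.$$
   Context: Digraphs here have no parallel arcs but may have loops (a loop counts as an arc). A walk of length $k$ from $u$ to $v$ is a sequence of vertices $u=v_0,\dots,v_k=v$ with each $(v_{i-1},v_i)$ an arc. A digraph is $\mathscr{F}_k$-free if for every ordered pair of vertices $(i,j)$ there is at most one walk of length $k$ from $i$ to $j$. $ex(n,\mathscr{F}_k)$ is the maximum number of arcs of an $\mathscr{F}_k$-free digraph of order $n$ (loops allowed). *)

theory Defs
  imports "Graph_Theory.Pair_Digraph" "Graph_Theory.Vertex_Walk" Complex_Main
begin

(* Arcs are ordered pairs, so there are no parallel arcs; pair_fin_digraph allows loops. *)

definition walk_betw :: "'a pair_pre_digraph \<Rightarrow> nat \<Rightarrow> 'a \<Rightarrow> 'a \<Rightarrow> 'a vwalk \<Rightarrow> bool" where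
  "walk_betw D k u v p \<longleftrightarrow>
     vwalk p (with_proj D) \<and> vwalk_length p = k \<and> hd p = u \<and> last p = v"

definition F_free :: "nat \<Rightarrow> 'a pair_pre_digraph \<Rightarrow> bool" where
  "F_free k D \<longleftrightarrow>
     (\<forall>u\<in>pverts D. \<forall>v\<in>pverts D. \<forall>p q.
        walk_betw D k u v p \<longrightarrow> walk_betw D k u v q \<longrightarrow> p = q)"

(* Every finite digraph is isomorphic to one with vertices in nat, so the choice of vertex
   type loses nothing; see card_arcs_le_ex_F. *)
definition F_free_digraphs :: "nat \<Rightarrow> nat \<Rightarrow> nat pair_pre_digraph set" where
  "F_free_digraphs n k = {D. pair_fin_digraph D \<and> card (pverts D) = n \<and> F_free k D}"

definition ex_F :: "nat \<Rightarrow> nat \<Rightarrow> nat" where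
  "ex_F n k = Max ((\<lambda>D. card (parcs D)) ` F_free_digraphs n k)"

lemma card_arcs_le_square:
  assumes "pair_fin_digraph D"
  shows "card (parcs D) \<le> card (pverts D) * card (pverts D)"
proof -
  interpret pair_fin_digraph D by fact
  have "parcs D \<subseteq> pverts D \<times> pverts D"
    using in_arcsD1 in_arcsD2 by auto
  then have "card (parcs D) \<le> card (pverts D \<times> pverts D)"
    using pair_finite_verts by (intro card_mono) auto
  then show ?thesis by (simp add: card_cartesian_product)
qed

lemma finite_arc_counts: "finite ((\<lambda>D. card (parcs D)) ` F_free_digraphs n k)"
proof -
  have "(\<lambda>D. card (parcs D)) ` F_free_digraphs n k \<subseteq> {..n * n}"
    using card_arcs_le_square by (auto simp: F_free_digraphs_def)
  then show ?thesis by (rule finite_subset) simp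
qed

lemma F_free_digraphs_nonempty: "F_free_digraphs n k \<noteq> {}"
proof -
  define D :: "nat pair_pre_digraph" where "D = \<lparr>pverts = {..<n}, parcs = {}\<rparr>"
  have fin: "pair_fin_digraph D" by unfold_locales (auto simp: D_def)
  have single: "\<exists>x. p = [x]" if "vwalk p (with_proj D)" for p
    using that by (cases p rule: vwalk_arcs.cases) (auto simp: vwalk_def D_def)
  have "F_free k D"
    unfolding F_free_def walk_betw_def by (metis single list.sel(1))
  moreover have "card (pverts D) = n" by (simp add: D_def)
  ultimately show ?thesis using fin by (auto simp: F_free_digraphs_def)
qed

lemma card_arcs_le_ex_F:
  fixes D :: "'a pair_pre_digraph"
  assumes D: "pair_fin_digraph D" "F_free k D"
  shows "card (parcs D) \<le> ex_F (card (pverts D)) k"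
proof -
  interpret pair_fin_digraph D by fact
  obtain f :: "'a \<Rightarrow> nat" where f: "inj_on f (pverts D)"
    using pair_finite_verts finite_imp_inj_to_nat_seg by blast
  define g where "g = inv_into (pverts D) f"
  define H where "H = \<lparr>pverts = f ` pverts D, parcs = map_prod f f ` parcs D\<rparr>"
  have sub: "parcs D \<subseteq> pverts D \<times> pverts D"
    using in_arcsD1 in_arcsD2 by auto
  have gf: "g (f x) = x" if "x \<in> pverts D" for x
    using that f by (simp add: g_def)
  have inj: "inj_on (map_prod f f) (parcs D)"
    using map_prod_inj_on[OF f f] sub by (rule inj_on_subset)
  have fin: "pair_fin_digraph H"
    using sub pair_finite_verts pair_finite_arcs by unfold_locales (auto simp: H_def)
  have walk: "vwalk (map g p) (with_proj D)" if "vwalk p (with_proj H)" for p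
  proof -
    have "set (vwalk_arcs (map g p)) = map_prod g g ` set (vwalk_arcs p)"
      by (induct p rule: vwalk_arcs.induct) auto
    moreover have "map_prod g g e \<in> parcs D" if "e \<in> parcs H" for e
      using that sub by (auto simp: H_def gf)
    moreover have "g x \<in> pverts D" if "x \<in> pverts H" for x
      using that by (auto simp: H_def gf)
    ultimately show ?thesis using that by (auto simp: vwalk_def)
  qed
  have "F_free k H"
    unfolding F_free_def
  proof (intro ballI allI impI)
    fix u v p q
    assume uv: "u \<in> pverts H" "v \<in> pverts H"
      and p: "walk_betw H k u v p" and q: "walk_betw H k u v q"
    have ne: "p \<noteq> []" "q \<noteq> []" and sets: "set p \<subseteq> pverts H" "set q \<subseteq> pverts H"
      using p q by (auto simp: walk_betw_def vwalk_def)
    have "walk_betw D k (g u) (g v) (map g p)" "walk_betw D k (g u) (g v) (map g q)"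
      using p q ne by (auto simp: walk_betw_def walk hd_map last_map)
    moreover have "g u \<in> pverts D" "g v \<in> pverts D"
      using uv by (auto simp: H_def gf)
    ultimately have "map g p = map g q"
      using D(2) by (auto simp: F_free_def)
    moreover have "inj_on g (pverts H)"
      by (auto simp: inj_on_def H_def gf)
    ultimately show "p = q"
      using sets by (metis inj_on_map_eq_map inj_on_subset sup.bounded_iff)
  qed
  moreover have "card (pverts H) = card (pverts D)"
    using f by (simp add: H_def card_image)
  ultimately have "H \<in> F_free_digraphs (card (pverts D)) k"
    using fin by (simp add: F_free_digraphs_def)
  then have "card (parcs H) \<le> ex_F (card (pverts D)) k"
    unfolding ex_F_def by (intro Max_ge finite_arc_counts) auto
  moreover have "card (parcs H) = card (parcs D)"
    using inj by (simp add: H_def card_image)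
  ultimately show ?thesis by simp
qed

end

theory Submission
  imports Defs
begin

text \<open>Write \<open>k = n - 4\<close>. Up to loops and digons (which add arcs), the number of arcs is
  \<open>n (n - 1) / 2\<close> minus the number of nonadjacent pairs. The lower bound comes from a complete
  multipartite acyclic digraph with only \<open>k\<close> levels, four of them of size two.

  If the digraph has a cycle, take a loop or digon \<open>C\<close> if there is one and a shortest cycle
  otherwise. Two short walks with the same ends that meet a cycle can be prolonged to length \<open>k\<close>,
  so vertices adjacent to all of \<open>C\<close> are (essentially) pairwise nonadjacent. Hence almost every
  vertex off \<open>C\<close> can be assigned a nonadjacent partner, which gives enough nonadjacent pairs to pay
  for all loops and digons and for four more pairs.

  If the digraph is acyclic with at most three nonadjacent pairs, deleting well-chosen vertices
  leaves two different transitive tournaments on \<open>k + 1\<close> vertices with the same source and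
  sink, whose Hamiltonian paths are two walks of length \<open>k\<close> with the same ends.\<close>

section \<open>Walks as vertex lists and as powers of the arc relation\<close>

lemma relpow_iff_walk:
  "(u, v) \<in> E ^^ m \<longleftrightarrow>
     (\<exists>xs. successively (\<lambda>x y. (x, y) \<in> E) xs \<and> length xs = Suc m \<and> hd xs = u \<and> last xs = v)"
proof (induction m arbitrary: v)
  case 0
  show ?case by (auto simp: length_Suc_conv intro: exI[of _ "[v]"])
next
  case (Suc m)
  show ?case
  proof
    assume "(u, v) \<in> E ^^ Suc m"
    then obtain w where "(u, w) \<in> E ^^ m" and wv: "(w, v) \<in> E" by auto
    then obtain xs where xs: "successively (\<lambda>x y. (x, y) \<in> E) xs" "length xs = Suc m"
        "hd xs = u" "last xs = w"
      using Suc.IH by blast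
    then have "xs \<noteq> []" by auto
    then show "\<exists>xs. successively (\<lambda>x y. (x, y) \<in> E) xs \<and> length xs = Suc (Suc m) \<and>
        hd xs = u \<and> last xs = v"
      using xs wv by (intro exI[of _ "xs @ [v]"]) (simp add: successively_append_iff)
  next
    assume "\<exists>xs. successively (\<lambda>x y. (x, y) \<in> E) xs \<and> length xs = Suc (Suc m) \<and>
        hd xs = u \<and> last xs = v"
    then obtain xs where xs: "successively (\<lambda>x y. (x, y) \<in> E) xs" "length xs = Suc (Suc m)"
        "hd xs = u" "last xs = v" by blast
    define ys where "ys = butlast xs"
    have ne: "xs \<noteq> []" using xs(2) by auto
    then have eq: "xs = ys @ [v]" using xs(4) by (metis append_butlast_last_id ys_def)
    have len: "length ys = Suc m" using xs(2) by (simp add: ys_def)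
    then have "ys \<noteq> []" by auto
    then have "successively (\<lambda>x y. (x, y) \<in> E) ys" "hd ys = u" "(last ys, v) \<in> E"
      using xs eq by (auto simp: successively_append_iff)
    then have "(u, last ys) \<in> E ^^ m" using Suc.IH len by blast
    then show "(u, v) \<in> E ^^ Suc m" using \<open>(last ys, v) \<in> E\<close> by auto
  qed
qed

text \<open>A closed walk of length \<open>s > 0\<close> repeated \<open>m\<close> times has length
  \<open>m * s\<close>, which is at least \<open>m\<close>. Its first \<open>m\<close> steps and its
  last \<open>m\<close> steps are the two walks wanted.\<close>

lemma trancl_loop_relpow:
  assumes "(x, x) \<in> E\<^sup>+"
  shows "\<exists>y. (x, y) \<in> E ^^ m" "\<exists>y. (y, x) \<in> E ^^ m"
proof -
  obtain s where s: "0 < s" "(x, x) \<in> E ^^ s" using assms by (auto simp: trancl_power)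
  have "(x, x) \<in> E ^^ (m * s)"
  proof (induction m)
    case (Suc m)
    then have "(x, x) \<in> E ^^ s O E ^^ (m * s)" using s by blast
    then show ?case by (simp add: relpow_add)
  qed simp
  moreover have "m \<le> m * s" using s by simp
  then obtain d where "m * s = m + d" using le_Suc_ex by blast
  ultimately have "(x, x) \<in> E ^^ (m + d)" "(x, x) \<in> E ^^ (d + m)" by (auto simp: add.commute)
  then show "\<exists>y. (x, y) \<in> E ^^ m" "\<exists>y. (y, x) \<in> E ^^ m"
    unfolding relpow_add by blast+
qed

section \<open>Local consequences of the uniqueness of walks of length \<open>k\<close>\<close>

locale unique_walks =
  fixes E :: "('a \<times> 'a) set" and k :: nat
  assumes unique: "\<lbrakk>successively (\<lambda>x y. (x, y) \<in> E) xs; successively (\<lambda>x y. (x, y) \<in> E) ys;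
      length xs = Suc k; length ys = Suc k; hd xs = hd ys; last xs = last ys\<rbrakk> \<Longrightarrow> xs = ys"
    and k_ge_4: "4 \<le> k"
begin

definition cyclic :: "'a \<Rightarrow> bool" where
  "cyclic x \<longleftrightarrow> (x, x) \<in> E\<^sup>+"

text \<open>Prefixing both tails by the same walk to \<open>x\<close> gives two walks of length
  \<open>k\<close> with the same ends; they part right after \<open>x\<close> unless
  \<open>a = b\<close>.\<close>

lemma branch:
  assumes "(u, x) \<in> E ^^ i" "(x, a) \<in> E" "(x, b) \<in> E" "(a, v) \<in> E ^^ j" "(b, v) \<in> E ^^ j"
    and "i + j + 1 = k"
  shows "a = b"
proof -
  obtain us as bs where w: "successively (\<lambda>x y. (x, y) \<in> E) us" "length us = Suc i" "hd us = u" "last us = x"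
      "successively (\<lambda>x y. (x, y) \<in> E) as" "length as = Suc j" "hd as = a" "last as = v"
      "successively (\<lambda>x y. (x, y) \<in> E) bs" "length bs = Suc j" "hd bs = b" "last bs = v"
    using assms(1,4,5) unfolding relpow_iff_walk by metis
  then have "us \<noteq> []" "as \<noteq> []" "bs \<noteq> []" by auto
  then have "us @ as = us @ bs"
    using w assms by (intro unique) (auto simp: successively_append_iff)
  then show ?thesis using w by simp
qed

text \<open>A short pair of distinct walks can be lengthened to \<^term>\<open>k\<close> by running around a cycle.\<close>

lemma short_branch:
  assumes "(u, a) \<in> E" "(u, b) \<in> E" "(a, v) \<in> E ^^ j" "(b, v) \<in> E ^^ j"
    and "j < k" "cyclic u \<or> cyclic v"
  shows "a = b"
  using assms(6)
proof
  assume "cyclic u"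
  \<comment> \<open>The lead-in of \<open>k - 1 - j\<close> steps, one arc and the tail of
    \<open>j\<close> steps add up to \<open>k\<close>.\<close>
  then obtain t where "(t, u) \<in> E ^^ (k - 1 - j)"
    using trancl_loop_relpow(2) unfolding cyclic_def by metis
  then show ?thesis using branch[OF _ assms(1-4)] assms(5) by simp
next
  assume "cyclic v"
  then obtain w where "(v, w) \<in> E ^^ (k - 1 - j)"
    using trancl_loop_relpow(1) unfolding cyclic_def by metis
  then have "(a, w) \<in> E ^^ (j + (k - 1 - j))" "(b, w) \<in> E ^^ (j + (k - 1 - j))"
    using assms(3,4) unfolding relpow_add by blast+
  then show ?thesis using branch[of u u 0 a b w] assms by simp
qed

text \<open>This lemma and the next two spell out \<open>short_branch\<close> for walks of lengths
  2, 3 and 4, comparing only the second vertices. Length 4 is the longest, and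
  \<open>4 \<le> k\<close> leaves room for it.\<close>

lemma unique_2:
  assumes "(u, a) \<in> E" "(a, v) \<in> E" "(u, b) \<in> E" "(b, v) \<in> E" "cyclic u \<or> cyclic v"
  shows "a = b"
  using short_branch[of u a b v 1] assms k_ge_4 by simp

lemma unique_3:
  assumes "(u, a) \<in> E" "(a, a') \<in> E" "(a', v) \<in> E" "(u, b) \<in> E" "(b, b') \<in> E" "(b', v) \<in> E"
    "cyclic u \<or> cyclic v"
  shows "a = b"
proof -
  have "(a, v) \<in> E ^^ 2" "(b, v) \<in> E ^^ 2" using assms by (auto simp: numeral_2_eq_2)
  then show ?thesis using short_branch[of u a b v 2] assms k_ge_4 by simp
qed

lemma unique_4:
  assumes "(u, a) \<in> E" "(a, a') \<in> E" "(a', a'') \<in> E" "(a'', v) \<in> E"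
    "(u, b) \<in> E" "(b, b') \<in> E" "(b', b'') \<in> E" "(b'', v) \<in> E" "cyclic u \<or> cyclic v"
  shows "a = b"
proof -
  have "(a, v) \<in> E ^^ 3" "(b, v) \<in> E ^^ 3" using assms by (auto simp: numeral_3_eq_3)
  then show ?thesis using short_branch[of u a b v 3] assms k_ge_4 by simp
qed

lemma cyclic_digon: "(x, y) \<in> E \<Longrightarrow> (y, x) \<in> E \<Longrightarrow> cyclic x"
  unfolding cyclic_def by (meson r_into_trancl trancl_trans)

text \<open>In the next two lemmas the digons may degenerate to loops.\<close>

lemma digon_unique:
  assumes "(x, y) \<in> E" "(y, x) \<in> E" "(x, z) \<in> E" "(z, x) \<in> E"
  shows "y = z"
  \<comment> \<open>Running through both digons in either order gives the closed walks
    \<open>x y x z x\<close> and \<open>x z x y x\<close>.\<close>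
  using unique_4[of x y x z x z x y] assms cyclic_digon by blast

lemma digons_nonadjacent:
  assumes "(x, x') \<in> E" "(x', x) \<in> E" "(y, y') \<in> E" "(y', y) \<in> E" "(x, y) \<in> E"
  shows "y = x'"
  \<comment> \<open>The competing walks are \<open>x y y' y\<close> and
    \<open>x x' x y\<close>.\<close>
  using unique_3[of x y y' y x' x] assms cyclic_digon by blast

text \<open>The digon and the triangle through \<open>u\<close> can be combined in two ways:
  \<open>y x y u x\<close> and \<open>y u x y x\<close> have the same ends.\<close>

lemma digon_triangle:
  assumes "(x, y) \<in> E" "(y, x) \<in> E" "(u, x) \<in> E" "(y, u) \<in> E"
  shows "u = x"
  using unique_4[of y x y u x u x y] assms cyclic_digon by blast

text \<open>Each of \<open>u\<close> and \<open>w\<close> has arcs to all of \<open>C\<close> or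
  from all of \<open>C\<close>. In each of the four combinations two walks with the same ends arise,
  at least one of them running through \<open>C\<close>.\<close>

lemma full_nonadjacent:
  assumes succ: "\<And>c. c \<in> C \<Longrightarrow> \<exists>d\<in>C. d \<noteq> c \<and> (c, d) \<in> E"
    and cyc: "\<And>c. c \<in> C \<Longrightarrow> cyclic c"
    and C: "C \<noteq> {}" "u \<notin> C" "w \<notin> C"
    and u: "(\<forall>c\<in>C. (u, c) \<in> E) \<or> (\<forall>c\<in>C. (c, u) \<in> E)"
    and w: "(\<forall>c\<in>C. (w, c) \<in> E) \<or> (\<forall>c\<in>C. (c, w) \<in> E)"
  shows "(u, w) \<notin> E"
proof
  assume uw: "(u, w) \<in> E"
  obtain c where c: "c \<in> C" using C by blast
  obtain d where d: "d \<in> C" "d \<noteq> c" "(c, d) \<in> E" using succ c by blast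
  consider (oo) "\<forall>c\<in>C. (u, c) \<in> E" "\<forall>c\<in>C. (w, c) \<in> E"
    | (oi) "\<forall>c\<in>C. (u, c) \<in> E" "\<forall>c\<in>C. (c, w) \<in> E"
    | (io) "\<forall>c\<in>C. (c, u) \<in> E" "\<forall>c\<in>C. (w, c) \<in> E"
    | (ii) "\<forall>c\<in>C. (c, u) \<in> E" "\<forall>c\<in>C. (c, w) \<in> E"
    using u w by blast
  then show False
  proof cases
    case oo
    then have "w = c" using unique_2[of u w d c] uw c d cyc by blast
    then show False using C c by blast
  next
    case oi
    \<comment> \<open>Here neither end is known to lie on a cycle, so the two walks are built with
      length exactly \<open>k\<close>: from \<open>u\<close> to \<open>c\<close> or
      \<open>d\<close>, then \<open>k - 2\<close> steps inside \<open>C\<close>, then to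
      \<open>w\<close>.\<close>
    have walk: "\<exists>e\<in>C. (b, e) \<in> E ^^ m" if "b \<in> C" for b m
      using that
    proof (induction m)
      case (Suc m)
      then obtain e where "e \<in> C" "(b, e) \<in> E ^^ m" by blast
      moreover then obtain e' where "e' \<in> C" "(e, e') \<in> E" using succ by blast
      ultimately show ?case by auto
    qed auto
    have "(b, w) \<in> E ^^ Suc (k - 2)" if "b \<in> C" for b
      using walk[OF that, of "k - 2"] oi by auto
    moreover have "0 + Suc (k - 2) + 1 = k" using k_ge_4 by simp
    ultimately have "c = d"
      using branch[OF relpow_0_I, of u c d w "Suc (k - 2)"] oi(1) c d(1) by (simp del: relpow.simps)
    then show False using d by blast
  next
    case io
    obtain e where e: "e \<in> C" "(d, e) \<in> E" using succ d by blast
    obtain f where f: "f \<in> C" "(e, f) \<in> E" using succ e by blast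
    have "u = d" using unique_3[of c u w f d e] io uw c d e f cyc by blast
    then show False using C d by blast
  next
    case ii
    then have "u = d" using unique_2[of c u w d] uw c d cyc by blast
    then show False using C d by blast
  qed
qed

end

section \<open>Counting arcs against nonadjacent pairs\<close>

locale finite_unique_walks = unique_walks E k for E :: "('a \<times> 'a) set" and k +
  fixes V :: "'a set"
  assumes finite_V: "finite V" and E_sub: "E \<subseteq> V \<times> V"
begin

definition adj :: "'a \<Rightarrow> 'a \<Rightarrow> bool" where
  "adj u v \<longleftrightarrow> (u, v) \<in> E \<or> (v, u) \<in> E"

text \<open>Pairs are ordered, so every nonadjacent pair and every digon is counted twice.\<close>

definition missing :: "('a \<times> 'a) set" where
  "missing = {(u, v). u \<in> V \<and> v \<in> V \<and> u \<noteq> v \<and> \<not> adj u v}"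

definition loops :: "'a set" where
  "loops = {x. (x, x) \<in> E}"

definition digons :: "('a \<times> 'a) set" where
  "digons = {(x, y). x \<noteq> y \<and> (x, y) \<in> E \<and> (y, x) \<in> E}"

lemma finites: "finite E" "finite missing" "finite loops" "finite digons"
proof -
  show E: "finite E" using finite_V E_sub by (meson finite_SigmaI finite_subset)
  show "finite missing" by (rule finite_subset[of _ "V \<times> V"]) (use finite_V in \<open>auto simp: missing_def\<close>)
  show "finite loops" by (rule finite_subset[of _ V]) (use finite_V E_sub in \<open>auto simp: loops_def\<close>)
  show "finite digons" by (rule finite_subset[of _ E]) (use E in \<open>auto simp: digons_def\<close>)
qed

lemma missing_sym: "(u, v) \<in> missing \<longleftrightarrow> (v, u) \<in> missing"
  by (auto simp: missing_def adj_def)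

text \<open>\<open>V \<times> V\<close> splits into the diagonal, the missing pairs and the union of
  the non-loop arcs with their reversals. In that union exactly the digons are hit from both
  sides.\<close>

lemma arc_count:
  "2 * card E + card missing + card V = card V * card V + 2 * card loops + card digons"
proof -
  define E' where "E' = E - Id"
  have fin: "finite E'" "finite (E'\<inverse>)" using finites by (auto simp: E'_def)
  have diag: "card ((\<lambda>x. (x, x)) ` A) = card A" for A :: "'a set"
    by (intro card_image inj_onI) auto
  have "E = E' \<union> (\<lambda>x. (x, x)) ` loops"
    by (auto simp: E'_def loops_def)
  moreover have "card \<dots> = card E' + card ((\<lambda>x. (x, x)) ` loops)"
    using fin finites by (intro card_Un_disjoint) (auto simp: E'_def)
  ultimately have 1: "card E = card E' + card loops" by (simp add: diag)
  have "E' \<inter> E'\<inverse> = digons" by (auto simp: E'_def digons_def)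
  then have 2: "2 * card E' = card (E' \<union> E'\<inverse>) + card digons"
    using card_Un_Int[OF fin] by simp
  have "V \<times> V = (missing \<union> (E' \<union> E'\<inverse>)) \<union> (\<lambda>x. (x, x)) ` V"
    using E_sub by (auto simp: missing_def E'_def adj_def)
  moreover have "card \<dots> = card (missing \<union> (E' \<union> E'\<inverse>)) + card ((\<lambda>x. (x, x)) ` V)"
    using fin finites finite_V by (intro card_Un_disjoint) (auto simp: missing_def E'_def)
  moreover have "card (missing \<union> (E' \<union> E'\<inverse>)) = card missing + card (E' \<union> E'\<inverse>)"
    using fin finites by (intro card_Un_disjoint) (auto simp: missing_def E'_def adj_def)
  ultimately have "card (V \<times> V) = card missing + card (E' \<union> E'\<inverse>) + card V"
    by (simp add: diag)
  then have "card V * card V = card missing + card (E' \<union> E'\<inverse>) + card V"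
    by (simp add: card_cartesian_product)
  then show ?thesis using 1 2 by simp
qed

text \<open>\<open>P\<close>, its converse and the missing pairs inside \<open>Z\<close> and inside
  \<open>V - Z\<close> are disjoint. The lemma is applied with \<open>P\<close> pairing every vertex
  off a small set \<open>Z\<close> with a partner in \<open>Z\<close>.\<close>

lemma card_missing_ge:
  assumes P: "P \<subseteq> missing" "P \<subseteq> (V - Z) \<times> Z"
  shows "2 * card P + card (missing \<inter> Z \<times> Z) + card (missing \<inter> (V - Z) \<times> (V - Z)) \<le> card missing"
proof -
  let ?A = "missing \<inter> Z \<times> Z" and ?B = "missing \<inter> (V - Z) \<times> (V - Z)"
  have fin: "finite P" "finite (P\<inverse>)" "finite ?A" "finite ?B"
    using P finites by (auto intro: finite_subset)
  have "card (P \<union> P\<inverse>) = card P + card (P\<inverse>)"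
    using fin P(2) by (intro card_Un_disjoint) auto
  moreover have "card (P \<union> P\<inverse> \<union> ?A) = card (P \<union> P\<inverse>) + card ?A"
    using fin P(2) by (intro card_Un_disjoint) auto
  moreover have "card (P \<union> P\<inverse> \<union> ?A \<union> ?B) = card (P \<union> P\<inverse> \<union> ?A) + card ?B"
    using fin P(2) by (intro card_Un_disjoint) auto
  moreover have "card (P \<union> P\<inverse> \<union> ?A \<union> ?B) \<le> card missing"
    using P(1) finites missing_sym by (intro card_mono) auto
  ultimately show ?thesis by simp
qed

definition full :: "'a set \<Rightarrow> 'a set" where
  "full C = {u \<in> V - C. \<forall>c\<in>C. adj u c}"

text \<open>A vertex off \<open>C\<close> that is not in \<open>full C\<close> misses a vertex of
  \<open>C\<close>. By \<open>full_nonadjacent\<close> the vertices of \<open>full C\<close> are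
  pairwise nonadjacent, so one of them, added to \<open>C\<close>, serves as partner for all the
  others.\<close>

lemma cover_missing:
  assumes C: "C \<subseteq> V" "C \<noteq> {}"
    and succ: "\<And>c. c \<in> C \<Longrightarrow> \<exists>d\<in>C. d \<noteq> c \<and> (c, d) \<in> E"
    and cyc: "\<And>c. c \<in> C \<Longrightarrow> cyclic c"
    and pure: "\<And>u. u \<in> full C \<Longrightarrow> (\<forall>c\<in>C. (u, c) \<in> E) \<or> (\<forall>c\<in>C. (c, u) \<in> E)"
  shows "\<exists>Z. C \<subseteq> Z \<and> Z \<subseteq> C \<union> full C \<and> card Z \<le> card C + 1 \<and>
    (\<forall>w\<in>V - Z. \<exists>z\<in>Z. (w, z) \<in> missing)"
proof (cases "full C = {}")
  case True
  have "\<exists>z\<in>C. (w, z) \<in> missing" if w: "w \<in> V - C" for w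
  proof -
    have "w \<notin> full C" using True by simp
    then obtain z where "z \<in> C" "\<not> adj w z" using w by (auto simp: full_def)
    then show ?thesis using w C by (auto simp: missing_def)
  qed
  then show ?thesis by (intro exI[of _ C]) auto
next
  case False
  then obtain a where a: "a \<in> full C" by blast
  have "finite C" using C finite_V finite_subset by blast
  have "\<not> adj w a" if "w \<in> full C" for w
    using full_nonadjacent[OF succ cyc C(2), of w a] full_nonadjacent[OF succ cyc C(2), of a w]
      pure[OF a] pure[OF that] a that
    by (auto simp: adj_def full_def)
  then have "\<exists>z\<in>insert a C. (w, z) \<in> missing" if "w \<in> V - insert a C" for w
    using that a C by (auto simp: full_def missing_def)
  then show ?thesis
    using a \<open>finite C\<close> by (intro exI[of _ "insert a C"]) (auto simp: card_insert_if)
qed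

lemma card_graph: "card ((\<lambda>w. (w, f w)) ` W) = card W"
  by (intro card_image inj_onI) auto

section \<open>Digraphs with a digon\<close>

text \<open>By \<open>digons_nonadjacent\<close> an arc from \<open>x\<close> to \<open>w\<close>
  forces \<open>w = y\<close>, and one from \<open>w\<close> to \<open>x\<close> forces
  \<open>x = w'\<close>. In the latter case \<open>digon_unique\<close> at \<open>x\<close> gives
  \<open>w = y\<close> again.\<close>

lemma digon_far:
  assumes "(w, w') \<in> E" "(w', w) \<in> E" "(x, y) \<in> E" "(y, x) \<in> E" "w \<noteq> x" "w \<noteq> y"
  shows "\<not> adj w x"
  using digons_nonadjacent[of w w' x y] digons_nonadjacent[of x y w w'] digon_unique[of x y w] assms
  unfolding adj_def by blast

text \<open>A vertex of a further loop or digon is nonadjacent to both ends of the given digon.\<close>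

lemma missing_bound_digon:
  assumes xy: "(x, y) \<in> digons"
  shows "2 * card loops + card digons + 2 * card V \<le> card missing + 8"
proof -
  have xy': "x \<noteq> y" "(x, y) \<in> E" "(y, x) \<in> E" and xyV: "x \<in> V" "y \<in> V"
    using xy E_sub by (auto simp: digons_def)
  have cyc: "cyclic x" "cyclic y" using cyclic_digon xy' by blast+
  \<comment> \<open>A vertex joined to \<open>x\<close> and \<open>y\<close> in opposite directions
    would close a triangle with an arc of the digon.\<close>
  have pure: "(\<forall>c\<in>{x, y}. (u, c) \<in> E) \<or> (\<forall>c\<in>{x, y}. (c, u) \<in> E)" if "u \<in> full {x, y}" for u
    using that digon_triangle[of x y u] digon_triangle[of y x u] xy'
    by (auto simp: full_def adj_def)
  have succ: "\<exists>d\<in>{x, y}. d \<noteq> c \<and> (c, d) \<in> E" if "c \<in> {x, y}" for c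
    using that xy' by auto
  have xy_sub: "{x, y} \<subseteq> V" and xy_ne: "{x, y} \<noteq> {}" using xyV by auto
  have xy_cyc: "cyclic c" if "c \<in> {x, y}" for c using that cyc by auto
  obtain Z where Z: "{x, y} \<subseteq> Z" "Z \<subseteq> {x, y} \<union> full {x, y}" "card Z \<le> card {x, y} + 1"
      "\<And>w. w \<in> V - Z \<Longrightarrow> \<exists>z\<in>Z. (w, z) \<in> missing"
    using cover_missing[OF xy_sub xy_ne succ xy_cyc pure] by blast
  \<comment> \<open>\<open>w' = w\<close> is allowed, so \<open>Q\<close> collects the other
    vertices that carry a loop or a digon.\<close>
  define Q where "Q = {w. \<exists>w'. (w, w') \<in> E \<and> (w', w) \<in> E} - {x, y}"
  have QV: "Q \<subseteq> V" using E_sub by (auto simp: Q_def)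
  then have finQ: "finite Q" using finite_V finite_subset by blast
  have Q: "(w, x) \<in> missing" "(w, y) \<in> missing" if w: "w \<in> Q" for w
  proof -
    obtain w' where w': "(w, w') \<in> E" "(w', w) \<in> E" "w \<noteq> x" "w \<noteq> y" "w \<in> V"
      using w QV unfolding Q_def by blast
    then have "\<not> adj w x" "\<not> adj w y"
      using digon_far[of w w' x y] digon_far[of w w' y x] xy' by auto
    then show "(w, x) \<in> missing" "(w, y) \<in> missing"
      using w' xyV by (auto simp: missing_def)
  qed
  have QZ: "Q \<inter> Z = {}"
  proof -
    have "w \<notin> full {x, y}" if "w \<in> Q" for w
      using Q(1)[OF that] by (auto simp: full_def missing_def)
    then show ?thesis using Z(2) by (auto simp: Q_def)
  qed
  \<comment> \<open>A vertex of \<open>Q\<close> is paired with \<open>x\<close> by \<open>f\<close>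
    and once more with \<open>y\<close> in \<open>P\<close>; the second pair pays for its loop or
    digon.\<close>
  define f where "f w = (if w \<in> Q then x else SOME z. z \<in> Z \<and> (w, z) \<in> missing)" for w
  have f: "f w \<in> Z \<and> (w, f w) \<in> missing" if "w \<in> V - Z" for w
    using Z(4)[OF that] Q Z(1) someI_ex[of "\<lambda>z. z \<in> Z \<and> (w, z) \<in> missing"]
    by (auto simp: f_def)
  define P where "P = (\<lambda>w. (w, f w)) ` (V - Z) \<union> (\<lambda>w. (w, y)) ` Q"
  have "card P = card (V - Z) + card Q"
    unfolding P_def using finite_V finQ xy'(1)
    by (subst card_Un_disjoint) (auto simp: card_graph f_def)
  moreover have "2 * card P \<le> card missing"
  proof -
    have "P \<subseteq> missing" using f Q by (auto simp: P_def)
    moreover have "P \<subseteq> (V - Z) \<times> Z" using f QV QZ Z(1) by (auto simp: P_def)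
    ultimately show ?thesis using card_missing_ge[of P Z] by linarith
  qed
  moreover have "card (V - Z) + 3 \<ge> card V"
  proof -
    have "finite Z" using Z(2) xyV by (intro finite_subset[OF _ finite_V]) (auto simp: full_def)
    then have "card V - card Z \<le> card (V - Z)" by (rule diff_card_le_card_Diff)
    then show ?thesis using Z(3) xy'(1) by simp
  qed
  moreover have "2 * card loops + card digons \<le> 2 * card Q + 2"
  proof -
    \<comment> \<open>By \<open>digon_unique\<close> a vertex carries either a loop or at most one
      digon, never both, so loops and first ends in \<open>T\<close> are counted by distinct
      vertices of \<open>Q\<close>. The summand 2 stands for the two orientations of the given
      digon.\<close>
    define T where "T = digons - {(x, y), (y, x)}"
    have u: "b = y" if "(x, b) \<in> E" "(b, x) \<in> E" for b
      using digon_unique[of x b y] that xy' by blast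
    have u': "b = x" if "(y, b) \<in> E" "(b, y) \<in> E" for b
      using digon_unique[of y b x] that xy' by blast
    have "inj_on fst T"
      using digon_unique by (fastforce simp: inj_on_def T_def digons_def)
    then have "card T = card (fst ` T)" by (simp add: card_image)
    moreover have "loops \<union> fst ` T \<subseteq> Q"
    proof
      fix w assume w: "w \<in> loops \<union> fst ` T"
      then obtain w' where w': "(w, w') \<in> E" "(w', w) \<in> E" "(w, w') \<notin> {(x, y), (y, x)}"
        using xy'(1) by (fastforce simp: loops_def T_def digons_def)
      then have "w \<noteq> x" "w \<noteq> y" using u[of w'] u'[of w'] by auto
      then show "w \<in> Q" using w' by (auto simp: Q_def)
    qed
    then have "card (loops \<union> fst ` T) \<le> card Q" using finQ by (rule card_mono[rotated])
    moreover have "loops \<inter> fst ` T = {}"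
      using digon_unique by (fastforce simp: loops_def T_def digons_def)
    then have "card (loops \<union> fst ` T) = card loops + card (fst ` T)"
      using finites by (intro card_Un_disjoint) (auto simp: T_def)
    moreover have "card digons \<le> card T + card {(x, y), (y, x)}"
      using diff_card_le_card_Diff[of "{(x, y), (y, x)}" digons] by (simp add: T_def)
    ultimately show ?thesis using xy'(1) by simp
  qed
  ultimately show ?thesis by linarith
qed

section \<open>Digraphs with a loop but no digon\<close>

text \<open>The in-neighbours \<open>A\<close> of \<open>x\<close> are pairwise nonadjacent, as are
  the out-neighbours \<open>B\<close>, and every other vertex misses \<open>x\<close>. With one
  representative of each nonempty class, \<open>Z\<close> has at most three vertices. If both
  classes occur, every further loop yields a second missing pair; otherwise \<open>Z\<close> is
  smaller and the missing pairs among the loops pay.\<close>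

lemma missing_bound_loop:
  assumes dig: "digons = {}" and x: "x \<in> loops"
  shows "2 * card loops + card digons + 2 * card V \<le> card missing + 8"
proof -
  have xE: "(x, x) \<in> E" and xV: "x \<in> V" and cyc: "cyclic x"
    using x E_sub cyclic_digon by (auto simp: loops_def)
  define A where "A = {u. u \<noteq> x \<and> (u, x) \<in> E}"
  define B where "B = {u. u \<noteq> x \<and> (x, u) \<in> E}"
  define Q where "Q = loops - {x}"
  have AV: "A \<subseteq> V" "B \<subseteq> V" and AB: "A \<inter> B = {}"
    using E_sub dig by (auto simp: A_def B_def digons_def)
  \<comment> \<open>An arc \<open>u w\<close> inside \<open>A\<close> would give the walks
    \<open>u w x\<close> and \<open>u x x\<close>; inside \<open>B\<close> the walks are
    \<open>x u w\<close> and \<open>x x w\<close>.\<close>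
  have A: "\<not> adj u w" if "u \<in> A" "w \<in> A" for u w
    using that unique_2[of u w x x] unique_2[of w u x x] xE cyc by (auto simp: A_def adj_def)
  have B: "\<not> adj u w" if "u \<in> B" "w \<in> B" for u w
    using that unique_2[of x w u x] unique_2[of x u w x] xE cyc by (auto simp: B_def adj_def)
  have QV: "Q \<subseteq> V" using E_sub by (auto simp: Q_def loops_def)
  then have finQ: "finite Q" using finite_V finite_subset by blast
  have cardL: "card loops = card Q + 1"
    using x finites card.remove[of loops x] by (simp add: Q_def)
  \<comment> \<open>Loops are degenerate digons, so \<open>digons_nonadjacent\<close> applies to two
    of them.\<close>
  have Q: "(u, w) \<in> missing" if "u \<in> loops" "w \<in> loops" "u \<noteq> w" for u w
    using that E_sub digons_nonadjacent[of u u w w] digons_nonadjacent[of w w u u]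
    by (auto simp: loops_def missing_def adj_def)
  have QAB: "Q \<inter> (A \<union> B) = {}"
    using Q[OF _ x] by (fastforce simp: Q_def A_def B_def missing_def adj_def)
  show ?thesis
  proof (cases "A = {} \<or> B = {}")
    case False
    then obtain a b where ab: "a \<in> A" "b \<in> B" by blast
    have xab: "x \<noteq> a" "x \<noteq> b" "a \<noteq> b" using ab AB by (auto simp: A_def B_def)
    define Z where "Z = {x, a, b}"
    have Z: "Z \<subseteq> V" "card Z = 3" "Q \<inter> Z = {}"
      using ab AB AV xV QAB xab by (auto simp: Z_def Q_def card_insert_if)
    text \<open>A loop \<^term>\<open>w\<close> adjacent to both \<^term>\<open>a\<close> and \<^term>\<open>b\<close> would either be joined to
      \<^term>\<open>x\<close> by a walk or give a second walk from \<^term>\<open>a\<close> to \<^term>\<open>b\<close>.\<close>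
    have gex: "\<exists>z\<in>{a, b}. (w, z) \<in> missing" if w: "w \<in> Q" for w
    proof (rule ccontr)
      assume "\<not> ?thesis"
      then have adj: "adj w a" "adj w b"
        using w QV ab AV Z(3) by (auto simp: missing_def Z_def)
      have wE: "(w, w) \<in> E" "w \<noteq> x" "w \<noteq> a" "w \<noteq> b" and cw: "cyclic w"
        using w Z(3) cyclic_digon by (auto simp: Q_def loops_def Z_def)
      \<comment> \<open>An arc \<open>w a\<close> would give \<open>w a x x\<close> and
        \<open>w w a x\<close>; an arc \<open>b w\<close> would give \<open>x b w w\<close> and
        \<open>x x b w\<close>.\<close>
      have "(w, a) \<notin> E"
        using unique_3[of w a x x w a] ab(1) wE xE cw unfolding A_def by blast
      moreover have "(b, w) \<notin> E"
        using unique_3[of x b w w x b] ab(2) wE xE cyc unfolding B_def by blast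
      ultimately have aw: "(a, w) \<in> E" "(w, b) \<in> E" using adj by (auto simp: adj_def)
      \<comment> \<open>Two walks of length \<open>k\<close> from \<open>a\<close> to
        \<open>b\<close> result: one waits \<open>k - 2\<close> steps at \<open>x\<close>, the other
        at \<open>w\<close>.\<close>
      have stay: "(v, v) \<in> E ^^ m" if "(v, v) \<in> E" for v m
        using that by (induction m) auto
      have "(x, b) \<in> E ^^ Suc (k - 2)" "(w, b) \<in> E ^^ Suc (k - 2)"
        using stay[OF xE, of "k - 2"] stay[OF wE(1), of "k - 2"] ab aw by (auto simp: B_def)
      moreover have "0 + Suc (k - 2) + 1 = k" using k_ge_4 by simp
      moreover have "(a, x) \<in> E" using ab by (simp add: A_def)
      ultimately have "x = w" using branch[OF relpow_0_I] aw(1) by blast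
      then show False using wE by simp
    qed
    define f where "f w = (if w \<in> A then a else if w \<in> B then b else x)" for w
    define g where "g w = (SOME z. z \<in> {a, b} \<and> (w, z) \<in> missing)" for w
    have f: "f w \<in> Z \<and> (w, f w) \<in> missing" if "w \<in> V - Z" for w
      using that A[of w a] B[of w b] ab AV xV
      by (auto simp: f_def Z_def missing_def A_def B_def adj_def)
    have g: "g w \<in> {a, b} \<and> (w, g w) \<in> missing" if "w \<in> Q" for w
      using gex[OF that] someI_ex[of "\<lambda>z. z \<in> {a, b} \<and> (w, z) \<in> missing"]
      unfolding g_def by blast
    have fx: "f w = x" if "w \<in> Q" for w using that QAB by (auto simp: f_def)
    \<comment> \<open>On \<open>Q\<close> the partner \<open>f w\<close> is \<open>x\<close>, while
      \<open>g w\<close> is \<open>a\<close> or \<open>b\<close>, so the two graphs are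
      disjoint.\<close>
    define P where "P = (\<lambda>w. (w, f w)) ` (V - Z) \<union> (\<lambda>w. (w, g w)) ` Q"
    have "(\<lambda>w. (w, f w)) ` (V - Z) \<inter> (\<lambda>w. (w, g w)) ` Q = {}"
      using g fx xab by fastforce
    then have "card P = card (V - Z) + card Q"
      unfolding P_def using finite_V finQ by (subst card_Un_disjoint) (auto simp: card_graph)
    moreover have "2 * card P \<le> card missing"
    proof -
      have "P \<subseteq> missing" using f g by (auto simp: P_def)
      moreover have "P \<subseteq> (V - Z) \<times> Z"
        using f g Z(3) QV by (fastforce simp: P_def Z_def)
      ultimately show ?thesis using card_missing_ge[of P Z] by linarith
    qed
    moreover have "card (V - Z) = card V - 3" "3 \<le> card V"
      using Z finite_V card_Diff_subset[of Z V] card_mono[of V Z] finite_subset by auto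
    ultimately show ?thesis using cardL dig by simp
  next
    case True
    obtain Z where Z: "x \<in> Z" "Z \<subseteq> V" "card Z \<le> 2" "Z \<subseteq> insert x (A \<union> B)"
      and cov: "\<And>w. w \<in> V - Z \<Longrightarrow> \<exists>z\<in>Z. (w, z) \<in> missing"
    proof (cases "A \<union> B = {}")
      case True
      show ?thesis
        by (rule that[of "{x}"])
          (use True xV in \<open>auto simp: A_def B_def missing_def adj_def\<close>)
    next
      case False
      then obtain a where a: "a \<in> A \<union> B" by blast
      have "\<exists>z\<in>{x, a}. (w, z) \<in> missing" if w: "w \<in> V - {x, a}" for w
      proof (cases "w \<in> A \<union> B")
        case True
        then have "\<not> adj w a" using \<open>A = {} \<or> B = {}\<close> a A[of w a] B[of w a] by blast
        then show ?thesis using w a AV by (auto simp: missing_def)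
      next
        case False
        then show ?thesis using w xV by (auto simp: A_def B_def missing_def adj_def)
      qed
      then show ?thesis
        using a AV xV by (intro that[of "{x, a}"]) (auto simp: card_insert_if)
    qed
    define f where "f w = (SOME z. z \<in> Z \<and> (w, z) \<in> missing)" for w
    have f: "f w \<in> Z \<and> (w, f w) \<in> missing" if "w \<in> V - Z" for w
      using cov[OF that] someI_ex[of "\<lambda>z. z \<in> Z \<and> (w, z) \<in> missing"] by (auto simp: f_def)
    have QZ: "Q \<subseteq> V - Z" using QV QAB Z(4) by (auto simp: Q_def)
    have "card (Q \<times> Q - (\<lambda>w. (w, w)) ` Q) = card Q * card Q - card Q"
      using finQ by (subst card_Diff_subset) (auto simp: card_graph[of id, simplified] card_cartesian_product)
    moreover have "Q \<times> Q - (\<lambda>w. (w, w)) ` Q \<subseteq> missing \<inter> (V - Z) \<times> (V - Z)"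
      using QZ Q by (auto simp: Q_def)
    then have "card (Q \<times> Q - (\<lambda>w. (w, w)) ` Q) \<le> card (missing \<inter> (V - Z) \<times> (V - Z))"
      using finites by (intro card_mono) auto
    moreover have "2 * card ((\<lambda>w. (w, f w)) ` (V - Z)) + card (missing \<inter> Z \<times> Z)
        + card (missing \<inter> (V - Z) \<times> (V - Z)) \<le> card missing"
      using f by (intro card_missing_ge) auto
    moreover have "card V \<le> card (V - Z) + 2"
      using diff_card_le_card_Diff[of Z V] Z finite_V finite_subset by fastforce
    \<comment> \<open>This is \<open>(q - 1) * (q - 2) \<ge> 0\<close> for
      \<open>q = card Q\<close>, exactly what the \<open>q * (q - 1)\<close> ordered missing pairs
      among the loops have to cover.\<close>
    moreover have "3 * card Q \<le> card Q * card Q + 2"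
    proof (cases "card Q \<le> 2")
      case True
      then consider "card Q = 0" | "card Q = 1" | "card Q = 2" by linarith
      then show ?thesis by cases auto
    next
      case False
      then have "3 * card Q \<le> card Q * card Q" by (intro mult_le_mono1) simp
      then show ?thesis by linarith
    qed
    ultimately show ?thesis using cardL dig by (simp add: card_graph)
  qed
qed

end

section \<open>Cyclic digraphs without loops and digons\<close>

text \<open>A closed walk of least positive length is extended periodically to all naturals, which
  avoids wrap-around when walking along it.\<close>

lemma shortest_cycle:
  assumes "\<not> acyclic E"
  shows "\<exists>s c. 0 < s \<and> (\<forall>i. (c i, c (Suc i)) \<in> E) \<and> (\<forall>i. c (i + s) = c i) \<and>
    (\<forall>t x. 0 < t \<longrightarrow> t < s \<longrightarrow> (x, x) \<notin> E ^^ t)"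
proof -
  define s where "s = (LEAST t. 0 < t \<and> (\<exists>x. (x, x) \<in> E ^^ t))"
  obtain y where "(y, y) \<in> E\<^sup>+" using assms by (auto simp: acyclic_def)
  then have "\<exists>t. 0 < t \<and> (\<exists>x. (x, x) \<in> E ^^ t)" by (auto simp: trancl_power)
  then have s: "0 < s \<and> (\<exists>x. (x, x) \<in> E ^^ s)" unfolding s_def by (rule LeastI_ex)
  then obtain f x where f: "f 0 = x" "f s = x" "\<And>i. i < s \<Longrightarrow> (f i, f (Suc i)) \<in> E"
    by (auto simp: relpow_fun_conv)
  show ?thesis
  proof (intro exI conjI allI impI)
    show "0 < s" using s by simp
    show "(f (i mod s), f (Suc i mod s)) \<in> E" for i
      using f(3)[of "i mod s"] f(1,2) s by (auto simp: mod_Suc)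
    show "f ((i + s) mod s) = f (i mod s)" for i by simp
    show "(y, y) \<notin> E ^^ t" if "0 < t" "t < s" for t y
      using not_less_Least[of t "\<lambda>t. 0 < t \<and> (\<exists>x. (x, x) \<in> E ^^ t)"] that by (auto simp: s_def)
  qed
qed

context finite_unique_walks
begin

text \<open>A shortest cycle is induced, so besides at least one missing pair for every vertex off the
  cycle but one, it leaves \<^term>\<open>s * (s - 3)\<close> ordered pairs of its own missing.\<close>

lemma missing_bound_long_cycle:
  assumes dig: "digons = {}" and lop: "loops = {}" and cyclicE: "\<not> acyclic E"
  shows "2 * card V \<le> card missing + 8"
proof -
  obtain s c where sc: "0 < s \<and> (\<forall>i. (c i, c (Suc i)) \<in> E) \<and> (\<forall>i. c (i + s) = c i) \<and>
      (\<forall>t x. 0 < t \<longrightarrow> t < s \<longrightarrow> (x, x) \<notin> E ^^ t)"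
    using shortest_cycle[OF cyclicE] by (elim exE)
  have s: "0 < s" and arc: "(c i, c (Suc i)) \<in> E" and per: "c (i + s) = c i"
    and short: "0 < t \<Longrightarrow> t < s \<Longrightarrow> (x, x) \<notin> E ^^ t" for i t x
    using sc by simp_all
  have walk: "(c i, c (i + d)) \<in> E ^^ d" for i d
    by (induction d) (use arc in auto)
  have no_loop: "(u, u) \<notin> E" for u using lop by (auto simp: loops_def)
  have no_digon: "(v, u) \<notin> E" if "(u, v) \<in> E" for u v
    using dig that no_loop by (cases "u = v") (auto simp: digons_def)
  have "s \<noteq> 1" using no_loop[of "c 0"] arc[of 0] per[of 0] by auto
  moreover have "s \<noteq> 2"
    using no_digon[OF arc[of 0]] arc[of 1] per[of 0] by (auto simp: numeral_2_eq_2)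
  ultimately have s3: "3 \<le> s" using s by linarith
  define C where "C = c ` {..<s}"
  have c_mod: "c (i mod s) = c i" for i
  proof -
    have "c (r + q * s) = c r" for r q
    proof (induction q)
      case (Suc q)
      then show ?case using per[of "r + q * s"] by (simp add: algebra_simps)
    qed simp
    from this[of "i mod s" "i div s"] show ?thesis by simp
  qed
  have cC: "c i \<in> C" for i
    using c_mod[of i] s unfolding C_def by (metis imageI lessThan_iff mod_less_divisor)
  have CE: "\<exists>i<s. x = c i" if "x \<in> C" for x using that by (auto simp: C_def)
  have inj: "inj_on c {..<s}"
  proof -
    have "c i \<noteq> c j" if "i < j" "j < s" for i j
    proof -
      have "0 < j - i" "j - i < s" "i + (j - i) = j" using that by linarith+
      then show ?thesis using walk[of i "j - i"] short[of "j - i" "c i"] by metis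
    qed
    then show ?thesis by (metis inj_onI lessThan_iff linorder_neqE_nat)
  qed
  then have cardC: "card C = s" by (simp add: C_def card_image)
  have finC: "finite C" by (simp add: C_def)
  have CV: "C \<subseteq> V" using arc E_sub by (auto simp: C_def)
  \<comment> \<open>A chord, followed by the way back from \<open>c j\<close> to \<open>c i\<close>
    along the cycle, would be a closed walk shorter than \<open>s\<close>.\<close>
  have chord: "c j = c (Suc i)" if "i < s" "j < s" "(c i, c j) \<in> E" for i j
  proof (rule ccontr)
    assume neq: "c j \<noteq> c (Suc i)"
    show False
    proof (cases "i < j")
      case True
      then have "j \<noteq> Suc i" using neq by auto
      then have "Suc (i + s - j) < s" using True that by simp
      moreover have "(c j, c i) \<in> E ^^ (i + s - j)"
        using walk[of j "i + s - j"] per[of i] that by simp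
      then have "(c i, c i) \<in> E ^^ Suc (i + s - j)" using that(3) by (rule relpow_Suc_I2[rotated])
      ultimately show False using short by blast
    next
      case False
      have "\<not> (i = s - 1 \<and> j = 0)"
      proof
        assume "i = s - 1 \<and> j = 0"
        then have "c (Suc i) = c 0" "c j = c 0" using per[of 0] s by simp_all
        then show False using neq by simp
      qed
      then have "Suc (i - j) < s" using False that by linarith
      moreover have "(c j, c i) \<in> E ^^ (i - j)" using walk[of j "i - j"] False by simp
      then have "(c i, c i) \<in> E ^^ Suc (i - j)" using that(3) by (rule relpow_Suc_I2[rotated])
      ultimately show False using short by blast
    qed
  qed
  have cyc: "cyclic x" if x: "x \<in> C" for x
  proof -
    obtain i where "x = c i" using CE[OF x] by blast
    then have "(x, x) \<in> E ^^ s" using walk[of i s] per[of i] by simp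
    then show ?thesis using s unfolding cyclic_def trancl_power by blast
  qed
  have pure: "(\<forall>x\<in>C. (u, x) \<in> E) \<or> (\<forall>x\<in>C. (x, u) \<in> E)" if u: "u \<in> full C" for u
  proof (rule ccontr)
    assume "\<not> ?thesis"
    then obtain i j where i: "(u, c i) \<notin> E" "i < s" and j: "(c j, u) \<notin> E" "j < s"
      using CE by blast
    have uC: "u \<notin> C" and adj: "(u, c i) \<in> E \<or> (c i, u) \<in> E" for i
      using u cC[of i] by (auto simp: full_def adj_def)
    \<comment> \<open>If \<open>u\<close> has arcs in both directions, going once round the cycle
      meets a place where an arc from \<open>u\<close> is followed by one into \<open>u\<close>.
      This closes a triangle, hence \<open>s = 3\<close>, and then \<open>u\<close> competes with
      the third cycle vertex.\<close>
    have "\<exists>i. (u, c i) \<in> E \<and> (c (Suc i), u) \<in> E"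
    proof (rule ccontr)
      assume "\<not> ?thesis"
      then have stay: "(u, c i) \<in> E \<Longrightarrow> (u, c (Suc i)) \<in> E" for i using adj by blast
      have "(u, c (j + d)) \<in> E" for d
        by (induction d) (use j adj[of j] stay in auto)
      from this[of "i + s - j"] show False using i j per[of i] by simp
    qed
    then obtain p where p: "(u, c p) \<in> E" "(c (Suc p), u) \<in> E" by blast
    then have "(u, u) \<in> E ^^ 3" using arc[of p] by (auto simp: numeral_3_eq_3)
    then have "s = 3" using short[of 3 u] s3 by linarith
    then have "c (Suc (Suc (Suc p))) = c p" using per[of p] by (simp add: numeral_3_eq_3)
    then have q: "(c (Suc (Suc p)), c p) \<in> E" using arc[of "Suc (Suc p)"] by simp
    have "u = c (Suc (Suc p))"
      using unique_2[OF p(2,1) arc q] cyc[OF cC] by blast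
    then show False using uC cC by blast
  qed
  have succ: "\<exists>d\<in>C. d \<noteq> x \<and> (x, d) \<in> E" if x: "x \<in> C" for x
    using CE[OF x] arc cC no_loop by metis
  have C0: "C \<noteq> {}" using cC by blast
  obtain Z where Z: "C \<subseteq> Z" "Z \<subseteq> C \<union> full C" "card Z \<le> card C + 1"
      "\<And>w. w \<in> V - Z \<Longrightarrow> \<exists>z\<in>Z. (w, z) \<in> missing"
    using cover_missing[OF CV C0 succ cyc pure] by blast
  define f where "f w = (SOME z. z \<in> Z \<and> (w, z) \<in> missing)" for w
  have f: "f w \<in> Z \<and> (w, f w) \<in> missing" if "w \<in> V - Z" for w
    using Z(4)[OF that] someI_ex[of "\<lambda>z. z \<in> Z \<and> (w, z) \<in> missing"] by (auto simp: f_def)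
  have "2 * card ((\<lambda>w. (w, f w)) ` (V - Z)) + card (missing \<inter> Z \<times> Z)
      + card (missing \<inter> (V - Z) \<times> (V - Z)) \<le> card missing"
    using f by (intro card_missing_ge) auto
  then have 1: "2 * card (V - Z) + card (missing \<inter> Z \<times> Z) \<le> card missing"
    by (simp add: card_graph)
  define B where "B = E \<inter> C \<times> C"
  \<comment> \<open>Without chords only the \<open>s\<close> cycle arcs lie inside \<open>C\<close>;
    with their reversals and the diagonal they leave at least \<open>s * s - 3 * s\<close> ordered
    pairs missing.\<close>
  have "B \<subseteq> (\<lambda>i. (c i, c (Suc i))) ` {..<s}"
    using chord unfolding B_def by (auto simp: C_def)
  then have B: "card B \<le> s"
    using card_mono[of "(\<lambda>i. (c i, c (Suc i))) ` {..<s}" B] card_image_le[of "{..<s}" "\<lambda>i. (c i, c (Suc i))"]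
    by simp
  have "C \<times> C \<subseteq> (missing \<inter> Z \<times> Z) \<union> B \<union> B\<inverse> \<union> (\<lambda>x. (x, x)) ` C"
    using Z(1) CV by (auto simp: missing_def adj_def B_def)
  then have "card (C \<times> C) \<le> card ((missing \<inter> Z \<times> Z) \<union> B \<union> B\<inverse> \<union> (\<lambda>x. (x, x)) ` C)"
    using finites finC by (intro card_mono) (auto simp: B_def)
  also have "\<dots> \<le> card (missing \<inter> Z \<times> Z) + card B + card (B\<inverse>) + card ((\<lambda>x. (x, x)) ` C)"
    by (meson add_le_mono1 card_Un_le le_trans)
  finally have 2: "s * s \<le> card (missing \<inter> Z \<times> Z) + 3 * s"
    using B cardC card_image_le[OF finC, of "\<lambda>x. (x, x)"] by (simp add: card_cartesian_product)
  have "finite Z" using Z(2) CV by (intro finite_subset[OF _ finite_V]) (auto simp: full_def)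
  then have 3: "card V - card Z \<le> card (V - Z)" by (rule diff_card_le_card_Diff)
  \<comment> \<open>The estimates combine as soon as \<open>5 * s \<le> s * s + 6\<close>, that is
    \<open>(s - 2) * (s - 3) \<ge> 0\<close>.\<close>
  obtain t where "s = t + 3" using s3 by (metis le_iff_add add.commute)
  then have "5 * s \<le> s * s + 6" by (simp add: algebra_simps)
  then show ?thesis using 1 2 3 Z(3) cardC by linarith
qed

lemma missing_bound_cyclic:
  assumes "\<not> acyclic E"
  shows "2 * card loops + card digons + 2 * card V \<le> card missing + 8"
  using missing_bound_digon missing_bound_loop missing_bound_long_cycle[OF _ _ assms]
  by (cases "digons = {}"; cases "loops = {}") auto

end

section \<open>Acyclic tournaments and their Hamiltonian paths\<close>

lemma acyclic_source:
  assumes "finite E" "acyclic E" "S \<noteq> {}"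
  shows "\<exists>v\<in>S. \<forall>u\<in>S. (u, v) \<notin> E"
proof -
  have "wf E" using assms(1,2) by (rule finite_acyclic_wf)
  then show ?thesis using assms(3) by (meson wfE_min')
qed

lemma acyclic_sink:
  assumes "finite E" "acyclic E" "S \<noteq> {}"
  shows "\<exists>v\<in>S. \<forall>u\<in>S. (v, u) \<notin> E"
  using acyclic_source[of "E\<inverse>" S] assms by simp

text \<open>A source has arcs to all other vertices, so it can be put in front of a Hamiltonian path
  of the rest.\<close>

lemma tournament_hamiltonian_path:
  assumes E: "finite E" "acyclic E" and S: "finite S" "S \<noteq> {}"
    and total: "\<And>u v. u \<in> S \<Longrightarrow> v \<in> S \<Longrightarrow> u \<noteq> v \<Longrightarrow> (u, v) \<in> E \<or> (v, u) \<in> E"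
  shows "\<exists>xs. distinct xs \<and> set xs = S \<and> successively (\<lambda>x y. (x, y) \<in> E) xs"
  using S total
proof (induction S rule: finite_psubset_induct)
  case (psubset S)
  obtain v where v: "v \<in> S" "\<And>u. u \<in> S \<Longrightarrow> (u, v) \<notin> E"
    using acyclic_source[OF E psubset.prems(1)] by metis
  show ?case
  proof (cases "S - {v} = {}")
    case True
    then have "S = {v}" using v by blast
    then show ?thesis by (intro exI[of _ "[v]"]) auto
  next
    case False
    have "S - {v} \<subset> S" using v by blast
    then obtain xs where xs: "distinct xs" "set xs = S - {v}" "successively (\<lambda>x y. (x, y) \<in> E) xs"
      using psubset.IH[of "S - {v}"] False psubset.prems(2) by auto
    then have "hd xs \<in> S - {v}" using False by (metis hd_in_set list.set(1))
    then have "(v, hd xs) \<in> E" using psubset.prems(2)[of v "hd xs"] v by auto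
    then show ?thesis
      using xs v(1) by (intro exI[of _ "v # xs"]) (auto simp: successively_Cons)
  qed
qed

lemma successively_hd:
  assumes "successively R xs" "v \<in> set xs" "\<And>u. u \<in> set xs \<Longrightarrow> \<not> R u v"
  shows "hd xs = v"
proof -
  obtain ys zs where xs: "xs = ys @ v # zs" using assms(2) by (meson split_list)
  have "ys = []"
  proof (rule ccontr)
    assume "ys \<noteq> []"
    then have "R (last ys) v" "last ys \<in> set xs"
      using assms(1) xs by (auto simp: successively_append_iff)
    then show False using assms(3) by blast
  qed
  then show ?thesis using xs by simp
qed

lemma successively_last:
  assumes "successively R xs" "v \<in> set xs" "\<And>u. u \<in> set xs \<Longrightarrow> \<not> R v u"
  shows "last xs = v"
proof -
  have "hd (rev xs) = v"
    using assms by (intro successively_hd[of "\<lambda>x y. R y x"]) auto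
  moreover have "xs \<noteq> []" using assms(2) by auto
  ultimately show ?thesis by (simp add: hd_rev)
qed

section \<open>Acyclic digraphs with few nonadjacent pairs\<close>

context finite_unique_walks
begin

definition gaps :: "'a set \<Rightarrow> ('a \<times> 'a) set" where
  "gaps S = missing \<inter> S \<times> S"

lemma finite_gaps: "finite (gaps S)"
  using finites by (simp add: gaps_def)

lemma gaps_sym: "(a, b) \<in> gaps S \<Longrightarrow> (b, a) \<in> gaps S"
  using missing_sym by (auto simp: gaps_def)

lemma gaps_irrefl: "(a, a) \<notin> gaps S"
  by (auto simp: gaps_def missing_def)

text \<open>Deleting \<open>a\<close> destroys the gaps between \<open>a\<close> and
  \<open>N\<close>, each in both orders.\<close>

lemma card_gaps_remove:
  assumes "N \<subseteq> {w. (a, w) \<in> gaps S}"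
  shows "card (gaps (S - {a})) + 2 * card N \<le> card (gaps S)"
proof -
  let ?A = "(\<lambda>w. (a, w)) ` N" and ?B = "(\<lambda>w. (w, a)) ` N"
  have "finite (fst ` gaps S \<union> snd ` gaps S)" using finite_gaps by simp
  then have fin: "finite N" by (rule finite_subset[rotated]) (use assms in force)
  have aN: "a \<notin> N" using assms gaps_irrefl by blast
  have "card (gaps (S - {a}) \<union> (?A \<union> ?B)) = card (gaps (S - {a})) + card (?A \<union> ?B)"
    using fin finite_gaps by (intro card_Un_disjoint) (auto simp: gaps_def)
  moreover have "card (?A \<union> ?B) = card ?A + card ?B"
    using fin aN by (intro card_Un_disjoint) auto
  moreover have "card ?A = card N" "card ?B = card N" by (auto intro!: card_image inj_onI)
  moreover have "gaps (S - {a}) \<union> (?A \<union> ?B) \<subseteq> gaps S"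
    using assms gaps_sym by (auto simp: gaps_def)
  then have "card (gaps (S - {a}) \<union> (?A \<union> ?B)) \<le> card (gaps S)"
    using finite_gaps by (intro card_mono)
  ultimately show ?thesis by linarith
qed

lemma card_gaps_remove_arc:
  assumes "(a, b) \<in> gaps S"
  shows "card (gaps (S - {a})) + 2 \<le> card (gaps S)"
  using card_gaps_remove[of "{b}" a S] assms by simp

text \<open>Gaps occur in both orders, so there cannot be exactly one.\<close>

lemma gaps_empty: "card (gaps S) \<le> 1 \<Longrightarrow> gaps S = {}"
  using card_gaps_remove_arc[of _ _ S] by fastforce

text \<open>Both tournaments below have a Hamiltonian path of length \<^term>\<open>k\<close> from \<^term>\<open>x\<close>
  to \<^term>\<open>z\<close>.\<close>

lemma two_tournaments_False:
  assumes acyc: "acyclic E" and S: "S \<subseteq> V" "card S = k + 2"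
    and ab: "a \<in> S" "b \<in> S" "a \<noteq> b" "gaps (S - {a}) = {}" "gaps (S - {b}) = {}"
    and x: "x \<in> S - {a, b}" "\<And>u. u \<in> S \<Longrightarrow> (u, x) \<notin> E"
    and z: "z \<in> S - {a, b}" "\<And>u. u \<in> S \<Longrightarrow> (z, u) \<notin> E"
  shows False
proof -
  have finS: "finite S" using S finite_V finite_subset by blast
  have path: "\<exists>xs. length xs = Suc k \<and> set xs = S - {d} \<and> successively (\<lambda>x y. (x, y) \<in> E) xs \<and>
      hd xs = x \<and> last xs = z" if d: "d \<in> {a, b}" for d
  proof -
    have "(u, v) \<in> E \<or> (v, u) \<in> E" if "u \<in> S - {d}" "v \<in> S - {d}" "u \<noteq> v" for u v
    proof -
      have "(u, v) \<notin> gaps (S - {d})" using d ab by auto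
      then show ?thesis using that S(1) by (auto simp: gaps_def missing_def adj_def)
    qed
    moreover have "S - {d} \<noteq> {}" using x d by auto
    ultimately obtain xs where xs: "distinct xs" "set xs = S - {d}"
        "successively (\<lambda>x y. (x, y) \<in> E) xs"
      using tournament_hamiltonian_path[OF finites(1) acyc, of "S - {d}"] finS by auto
    have "length xs = card (S - {d})" using xs distinct_card by metis
    also have "\<dots> = Suc k" using S(2) d ab finS by auto
    finally have "length xs = Suc k" .
    moreover have "hd xs = x"
      by (rule successively_hd[OF xs(3)]) (use xs(2) x d in auto)
    moreover have "last xs = z"
      by (rule successively_last[OF xs(3)]) (use xs(2) z d in auto)
    ultimately show ?thesis using xs by blast
  qed
  obtain xs where xs: "length xs = Suc k" "set xs = S - {a}" "successively (\<lambda>x y. (x, y) \<in> E) xs"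
      "hd xs = x" "last xs = z" using path[of a] by blast
  obtain ys where ys: "length ys = Suc k" "set ys = S - {b}" "successively (\<lambda>x y. (x, y) \<in> E) ys"
      "hd ys = x" "last ys = z" using path[of b] by blast
  have "xs = ys" using unique[of xs ys] xs ys by simp
  then show False using xs(2) ys(2) ab by auto
qed

lemma two_avoiding:
  assumes "finite S" "4 \<le> card S"
  obtains a b where "a \<in> S - {x, z}" "b \<in> S - {x, z}" "a \<noteq> b"
proof -
  have "card {x, z} \<le> 2" by (simp add: card_insert_if)
  then have c: "2 \<le> card (S - {x, z})"
    using assms diff_card_le_card_Diff[of "{x, z}" S] by simp
  then have "S - {x, z} \<noteq> {}" by force
  then obtain a where a: "a \<in> S - {x, z}" by blast
  have "S - {x, z} \<noteq> {a}" using c by force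
  then obtain b where "b \<in> S - {x, z}" "a \<noteq> b" using a by blast
  then show ?thesis using a that by blast
qed

text \<open>At most three ordered gaps form at most one unordered gap, and it avoids
  \<open>x\<close> and \<open>z\<close>. Deleting either end of it, or either of two inner vertices
  if there is none, leaves two tournaments with source \<open>x\<close> and sink
  \<open>z\<close>.\<close>

lemma few_gaps_False:
  assumes acyc: "acyclic E" and S: "S \<subseteq> V" "card S = k + 2" "card (gaps S) \<le> 3"
    and x: "x \<in> S" "\<And>u. u \<in> S \<Longrightarrow> (u, x) \<notin> E" "\<And>w. (x, w) \<notin> gaps S"
    and z: "z \<in> S" "\<And>u. u \<in> S \<Longrightarrow> (z, u) \<notin> E" "\<And>w. (z, w) \<notin> gaps S"
  shows False
proof -
  have finS: "finite S" using S finite_V finite_subset by blast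
  obtain a b where ab: "a \<in> S - {x, z}" "b \<in> S - {x, z}" "a \<noteq> b"
      "gaps (S - {a}) = {}" "gaps (S - {b}) = {}"
  proof (cases "gaps S = {}")
    case True
    then have "gaps (S - {d}) = {}" for d by (auto simp: gaps_def)
    moreover obtain a b where "a \<in> S - {x, z}" "b \<in> S - {x, z}" "a \<noteq> b"
      by (rule two_avoiding[OF finS, of x z]) (use k_ge_4 S(2) in simp_all)
    ultimately show ?thesis using that by blast
  next
    case False
    then obtain a b where ab: "(a, b) \<in> gaps S" by (metis ex_in_conv surj_pair)
    then have ba: "(b, a) \<in> gaps S" by (rule gaps_sym)
    have "gaps (S - {a}) = {}" "gaps (S - {b}) = {}"
      using gaps_empty card_gaps_remove_arc[OF ab] card_gaps_remove_arc[OF ba] S(3) by auto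
    moreover have "a \<noteq> b" using ab gaps_irrefl by blast
    moreover have "a \<in> S" "b \<in> S" using ab by (simp_all add: gaps_def)
    moreover have "a \<notin> {x, z}" "b \<notin> {x, z}" using ab ba x(3) z(3) by blast+
    then have "a \<in> S - {x, z}" "b \<in> S - {x, z}" using calculation by blast+
    ultimately show ?thesis using that by blast
  qed
  show False
  proof (rule two_tournaments_False[OF acyc S(1,2) _ _ ab(3-5)])
    show "x \<in> S - {a, b}" "z \<in> S - {a, b}" "a \<in> S" "b \<in> S" using ab(1,2) x(1) z(1) by auto
  qed (use x(2) z(2) in blast)+
qed

lemma no_gaps_False:
  assumes acyc: "acyclic E" and S: "S \<subseteq> V" "card S = k + 2" "gaps S = {}"
  shows False
proof -
  have "S \<noteq> {}" using S(2) by auto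
  then obtain x z where "x \<in> S" "\<And>u. u \<in> S \<Longrightarrow> (u, x) \<notin> E" "z \<in> S" "\<And>u. u \<in> S \<Longrightarrow> (z, u) \<notin> E"
    using acyclic_source[OF finites(1) acyc] acyclic_sink[OF finites(1) acyc] by metis
  then show False using few_gaps_False[OF acyc S(1,2), of x z] S(3) by simp
qed

text \<open>Deleting an end of the only possible gap leaves a tournament on \<open>k + 2\<close>
  vertices.\<close>

lemma one_gap_False:
  assumes acyc: "acyclic E" and S: "S \<subseteq> V" "card S = k + 3" "card (gaps S) \<le> 3"
  shows False
proof -
  have finS: "finite S" using S finite_V finite_subset by blast
  obtain a where a: "a \<in> S" "gaps (S - {a}) = {}"
  proof (cases "gaps S = {}")
    case True
    then have "gaps (S - {d}) = {}" for d by (auto simp: gaps_def)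
    moreover obtain a where "a \<in> S" using S(2) by fastforce
    ultimately show ?thesis using that by blast
  next
    case False
    then obtain a b where ab: "(a, b) \<in> gaps S" by (metis ex_in_conv surj_pair)
    then have "gaps (S - {a}) = {}"
      using gaps_empty card_gaps_remove_arc[OF ab] S(3) by simp
    moreover have "a \<in> S" using ab by (simp add: gaps_def)
    ultimately show ?thesis using that by blast
  qed
  show False using no_gaps_False[OF acyc _ _ a(2)] S a(1) finS by auto
qed

text \<open>Deleting the partner of \<^term>\<open>z\<close> if there is one, and otherwise an end of any missing pair.\<close>

lemma isolate:
  assumes S: "finite S" "4 \<le> card S"
    and x: "\<And>w. (x, w) \<in> gaps S \<Longrightarrow> x = z"
    and z: "z \<in> S" "\<And>u w. (z, u) \<in> gaps S \<Longrightarrow> (z, w) \<in> gaps S \<Longrightarrow> u = w"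
  shows "\<exists>p\<in>S - {x, z}. (\<forall>w. (z, w) \<notin> gaps (S - {p})) \<and>
    card (gaps (S - {p})) \<le> card (gaps S) - 2"
proof -
  consider (partner) p where "(z, p) \<in> gaps S"
    | (other) p q where "\<And>w. (z, w) \<notin> gaps S" "(p, q) \<in> gaps S"
    | (none) "gaps S = {}"
    using ex_in_conv[of "gaps S"] by fast
  then show ?thesis
  proof cases
    case partner
    then have pz: "(p, z) \<in> gaps S" by (rule gaps_sym)
    have "p \<noteq> z" using gaps_irrefl partner by blast
    moreover then have "p \<noteq> x" using x[of z] pz by blast
    ultimately have "p \<in> S - {x, z}" using partner by (simp add: gaps_def)
    moreover have "(z, w) \<notin> gaps (S - {p})" for w
      using z(2)[OF partner, of w] by (auto simp: gaps_def)
    moreover have "card (gaps (S - {p})) \<le> card (gaps S) - 2"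
      using card_gaps_remove_arc[OF pz] by linarith
    ultimately show ?thesis by blast
  next
    case other
    then have "p \<noteq> z" by blast
    moreover then have "p \<noteq> x" using x[of q] other(2) by blast
    ultimately have "p \<in> S - {x, z}" using other(2) by (simp add: gaps_def)
    moreover have "(z, w) \<notin> gaps (S - {p})" for w
      using other(1)[of w] by (auto simp: gaps_def)
    moreover have "card (gaps (S - {p})) \<le> card (gaps S) - 2"
      using card_gaps_remove_arc[OF other(2)] by linarith
    ultimately show ?thesis by blast
  next
    case none
    then have "gaps (S - {d}) = {}" for d by (auto simp: gaps_def)
    moreover obtain d where "d \<in> S - {x, z}" using two_avoiding[OF S, of x z] by blast
    ultimately show ?thesis by (intro bexI[of _ d]) auto
  qed
qed

text \<open>With at most three unordered gaps, these form a matching. Two deletions then free the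
  source and the sink of gaps and leave at most one gap on \<open>k + 2\<close> vertices.\<close>

lemma missing_bound_acyclic:
  assumes acyc: "acyclic E" and V: "card V = k + 4"
  shows "8 \<le> card missing"
proof (rule ccontr)
  assume "\<not> ?thesis"
  moreover have "gaps V = missing" by (auto simp: gaps_def missing_def)
  ultimately have 7: "card (gaps V) \<le> 7" by simp
  have V0: "V \<noteq> {}" using V by auto
  \<comment> \<open>Deleting a vertex in two gaps would leave at most one gap on
    \<open>k + 3\<close> vertices.\<close>
  have matching: "u = w" if uw: "(v, u) \<in> gaps V" "(v, w) \<in> gaps V" for u v w
  proof (rule ccontr)
    assume "u \<noteq> w"
    then have "card (gaps (V - {v})) \<le> 3"
      using card_gaps_remove[of "{u, w}" v V] uw 7 by simp
    moreover have "v \<in> V" using uw by (auto simp: gaps_def)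
    then have "card (V - {v}) = k + 3" using V finite_V by simp
    ultimately show False using one_gap_False[OF acyc, of "V - {v}"] by auto
  qed
  obtain x where x: "x \<in> V" "\<And>u. u \<in> V \<Longrightarrow> (u, x) \<notin> E"
    using acyclic_source[OF finites(1) acyc V0] by blast
  \<comment> \<open>\<open>isolate\<close> is used with both vertices equal to \<open>x\<close>, so
    that only the source is protected and freed.\<close>
  have "\<exists>p\<in>V - {x, x}. (\<forall>w. (x, w) \<notin> gaps (V - {p})) \<and>
      card (gaps (V - {p})) \<le> card (gaps V) - 2"
  proof (rule isolate[of V x x])
    show "4 \<le> card V" using V by simp
    show "u = w" if "(x, u) \<in> gaps V" "(x, w) \<in> gaps V" for u w using matching[OF that] .
  qed (use finite_V x(1) in auto)
  then obtain p where p: "p \<in> V - {x, x}" "\<And>w. (x, w) \<notin> gaps (V - {p})"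
      "card (gaps (V - {p})) \<le> card (gaps V) - 2"
    by blast
  define S where "S = V - {p}"
  have S: "finite S" "card S = k + 3" using p(1) finite_V V by (auto simp: S_def)
  then have S0: "S \<noteq> {}" by auto
  obtain z where z: "z \<in> S" "\<And>u. u \<in> S \<Longrightarrow> (z, u) \<notin> E"
    using acyclic_sink[OF finites(1) acyc S0] by blast
  have sub: "gaps S \<subseteq> gaps V" by (auto simp: S_def gaps_def)
  \<comment> \<open>The source \<open>x\<close> has no gap left in \<open>S\<close>, so the second
    deletion spares it as well as \<open>z\<close>. The ordered gaps drop from 7 to 5 and now to
    3.\<close>
  have "\<exists>q\<in>S - {x, z}. (\<forall>w. (z, w) \<notin> gaps (S - {q})) \<and>
      card (gaps (S - {q})) \<le> card (gaps S) - 2"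
  proof (rule isolate[of S x z])
    show "4 \<le> card S" using S k_ge_4 by simp
    show "x = z" if "(x, w) \<in> gaps S" for w using that p(2)[of w] by (simp add: S_def)
    show "u = w" if "(z, u) \<in> gaps S" "(z, w) \<in> gaps S" for u w
      using matching[of z u w] that sub by blast
  qed (use S(1) z(1) in auto)
  then obtain q where q: "q \<in> S - {x, z}" "\<And>w. (z, w) \<notin> gaps (S - {q})"
      "card (gaps (S - {q})) \<le> card (gaps S) - 2"
    by blast
  show False
  proof (rule few_gaps_False[OF acyc, of "S - {q}" x z])
    show "card (S - {q}) = k + 2" using q(1) S by simp
    show "card (gaps (S - {q})) \<le> 3" using q(3) p(3) 7 by (simp add: S_def)
    show "(x, w) \<notin> gaps (S - {q})" for w using p(2)[of w] by (auto simp: S_def gaps_def)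
    show "x \<in> S - {q}" "z \<in> S - {q}" using p(1) q(1) x(1) z(1) by (auto simp: S_def)
    show "(u, x) \<notin> E" "(z, u) \<notin> E" if "u \<in> S - {q}" for u
      using that x(2)[of u] z(2)[of u] by (auto simp: S_def)
    show "(z, w) \<notin> gaps (S - {q})" for w by (rule q(2))
  qed (auto simp: S_def)
qed

text \<open>Either way the missing pairs exceed \<open>2 * card loops + card digons\<close> by at
  least 8; in the cyclic case because \<open>2 * card V - 8 \<ge> 8\<close>.\<close>

lemma card_arcs_le:
  assumes V: "card V = k + 4"
  shows "2 * card E + card V + 8 \<le> card V * card V"
proof (cases "acyclic E")
  case True
  then have "\<not> cyclic x" for x by (simp add: cyclic_def acyclic_def)
  then have "loops = {}" "digons = {}"
    using cyclic_digon unfolding loops_def digons_def by blast+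
  then show ?thesis using arc_count missing_bound_acyclic[OF True V] by simp
next
  case False
  then show ?thesis using arc_count missing_bound_cyclic k_ge_4 V by linarith
qed

end

section \<open>From digraphs to the arc relation\<close>

lemma vwalk_arcs_subset_iff: "set (vwalk_arcs p) \<subseteq> A \<longleftrightarrow> successively (\<lambda>x y. (x, y) \<in> A) p"
  by (induction p rule: vwalk_arcs.induct) auto

lemma successively_set_subset:
  assumes "successively (\<lambda>x y. (x, y) \<in> A) p" "2 \<le> length p" "A \<subseteq> V \<times> V"
  shows "set p \<subseteq> V"
  using assms
proof (induction p rule: vwalk_arcs.induct)
  case (3 x y xs)
  then show ?case by (cases xs) auto
qed auto

text \<open>A walk with at least one arc has all its vertices on arcs, hence automatically in
  \<open>pverts D\<close>.\<close>

lemma walk_betw_iff: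
  assumes "parcs D \<subseteq> pverts D \<times> pverts D" "1 \<le> k"
  shows "walk_betw D k u v p \<longleftrightarrow> successively (\<lambda>x y. (x, y) \<in> parcs D) p \<and> length p = Suc k \<and>
    hd p = u \<and> last p = v"
  using assms successively_set_subset[OF _ _ assms(1), of p]
  by (auto simp: walk_betw_def vwalk_def vwalk_arcs_subset_iff)

lemma F_free_unique_walks:
  assumes D: "pair_fin_digraph D" "F_free k D" and k: "4 \<le> k"
  shows "finite_unique_walks (parcs D) k (pverts D)"
proof -
  interpret pair_fin_digraph D by fact
  have sub: "parcs D \<subseteq> pverts D \<times> pverts D" using in_arcsD1 in_arcsD2 by auto
  show ?thesis
  proof
    fix xs ys
    assume w: "successively (\<lambda>x y. (x, y) \<in> parcs D) xs" "successively (\<lambda>x y. (x, y) \<in> parcs D) ys"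
      "length xs = Suc k" "length ys = Suc k" "hd xs = hd ys" "last xs = last ys"
    then have "walk_betw D k (hd xs) (last xs) xs" "walk_betw D k (hd xs) (last xs) ys"
      using walk_betw_iff[OF sub, of k] k by auto
    moreover have "set xs \<subseteq> pverts D" "xs \<noteq> []"
      using successively_set_subset[OF w(1) _ sub] w(3) k by auto
    then have "hd xs \<in> pverts D" "last xs \<in> pverts D" by auto
    ultimately show "xs = ys" using D(2) unfolding F_free_def by blast
  qed (use k sub pair_finite_verts in auto)
qed

section \<open>The extremal digraph\<close>

text \<open>The vertices below 8 form four levels of size two and each later vertex is a level of
  its own, so \<open>n \<ge> 8\<close> vertices occupy the levels \<open>0\<close> to
  \<open>n - 5\<close>.\<close>

definition level :: "nat \<Rightarrow> nat" where
  "level i = (if i < 8 then i div 2 else i - 4)"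

definition levels_digraph :: "nat \<Rightarrow> nat pair_pre_digraph" where
  "levels_digraph n = \<lparr>pverts = {..<n}, parcs = {(i, j). i < j \<and> j < n \<and> level i < level j}\<rparr>"

lemma card_less_pairs: "2 * card {(i, j). i < j \<and> j < n} + n = n * (n :: nat)"
proof (induction n)
  case (Suc n)
  have "{(i, j). i < j \<and> j < Suc n} = {(i, j). i < j \<and> j < n} \<union> (\<lambda>i. (i, n)) ` {..<n}"
    by auto
  moreover have "finite {(i, j). i < j \<and> j < n}"
    by (rule finite_subset[of _ "{..<n} \<times> {..<n}"]) auto
  moreover have "card ((\<lambda>i. (i, n)) ` {..<n}) = n" by (subst card_image) (auto intro: inj_onI)
  moreover have "{(i, j). i < j \<and> j < n} \<inter> (\<lambda>i. (i, n)) ` {..<n} = {}" by auto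
  ultimately have "card {(i, j). i < j \<and> j < Suc n} = card {(i, j). i < j \<and> j < n} + n"
    by (simp add: card_Un_disjoint)
  then show ?case using Suc by simp
qed simp

text \<open>Of all pairs \<open>i < j\<close> only the four inside a level of size two are lost; the
  count is doubled, hence the 8.\<close>

lemma card_levels_digraph:
  assumes "8 \<le> n"
  shows "2 * card (parcs (levels_digraph n)) + n + 8 = n * n"
proof -
  let ?F = "{(0, 1), (2, 3), (4, 5), (6, 7)} :: (nat \<times> nat) set"
  have "(i, j) \<in> ?F" if "i < j" "\<not> level i < level j" for i j
  proof -
    have "j < 8" using that by (auto simp: level_def split: if_splits)
    then have "j \<in> {0, 1, 2, 3, 4, 5, 6, 7}" by auto
    moreover have "i < 8" "j div 2 \<le> i div 2" using that \<open>j < 8\<close> by (auto simp: level_def)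
    moreover then have "i = 2 * (j div 2)" "j = 2 * (j div 2) + 1" using that(1) by linarith+
    ultimately show ?thesis by auto
  qed
  then have "{(i, j). i < j \<and> j < n} = parcs (levels_digraph n) \<union> ?F"
    using assms by (auto simp: levels_digraph_def)
  moreover have "finite (parcs (levels_digraph n))"
    by (rule finite_subset[of _ "{..<n} \<times> {..<n}"]) (auto simp: levels_digraph_def)
  moreover have "parcs (levels_digraph n) \<inter> ?F = {}"
    by (auto simp: levels_digraph_def level_def)
  ultimately have "card {(i, j). i < j \<and> j < n} = card (parcs (levels_digraph n)) + card ?F"
    by (simp only: card_Un_disjoint finite.intros)
  then show ?thesis using card_less_pairs[of n] by simp
qed

text \<open>Every arc raises \<open>f\<close> by at least one, so the range of \<open>f\<close>
  bounds the length of a walk.\<close>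

lemma successively_strict_length:
  fixes f :: "'a \<Rightarrow> nat"
  assumes "successively (\<lambda>x y. (x, y) \<in> A) p" "p \<noteq> []" "\<And>x y. (x, y) \<in> A \<Longrightarrow> f x < f y"
  shows "f (hd p) + length p \<le> f (last p) + 1"
  using assms(1,2)
proof (induction p rule: vwalk_arcs.induct)
  case (3 x y xs)
  then have "f x < f y" "f y + length (y # xs) \<le> f (last (y # xs)) + 1"
    using assms(3) by auto
  then show ?case by simp
qed auto

lemma levels_digraph_fin: "pair_fin_digraph (levels_digraph n)"
proof
  show "finite (parcs (levels_digraph n))"
    by (rule finite_subset[of _ "{..<n} \<times> {..<n}"]) (auto simp: levels_digraph_def)
qed (auto simp: levels_digraph_def)

text \<open>There are only \<^term>\<open>n - 4\<close> levels, hence no walk of length \<^term>\<open>n - 4\<close> at all.\<close>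

lemma F_free_levels_digraph:
  assumes "8 \<le> n"
  shows "F_free (n - 4) (levels_digraph n)"
proof -
  let ?D = "levels_digraph n"
  have sub: "parcs ?D \<subseteq> pverts ?D \<times> pverts ?D" by (auto simp: levels_digraph_def)
  have False if "walk_betw ?D (n - 4) u v p" for u v p
  proof -
    have p: "successively (\<lambda>x y. (x, y) \<in> parcs ?D) p" "length p = Suc (n - 4)"
      using that walk_betw_iff[OF sub, of "n - 4"] assms by auto
    then have "p \<noteq> []" by auto
    then have "length p \<le> level (last p) + 1"
      using successively_strict_length[OF p(1), of level] by (auto simp: levels_digraph_def)
    moreover have "set p \<subseteq> {..<n}"
      using successively_set_subset[OF p(1) _ sub] p(2) assms by (simp add: levels_digraph_def)
    then have "last p < n" using last_in_set[OF \<open>p \<noteq> []\<close>] by blast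
    then have "level (last p) < n - 4" using assms by (auto simp: level_def)
    ultimately show False using p(2) by simp
  qed
  then show ?thesis by (auto simp: F_free_def)
qed

section \<open>The extremal number\<close>

theorem theorem10:
  fixes n :: nat
  assumes "n \<ge> 8"
  shows "real (ex_F n (n - 4)) = real n * (real n - 1) / 2 - 4"
proof -
  \<comment> \<open>The maximum over a finite nonempty set is attained, so the upper bound can be
    applied to one extremal digraph.\<close>
  have "ex_F n (n - 4) \<in> (\<lambda>D. card (parcs D)) ` F_free_digraphs n (n - 4)"
    unfolding ex_F_def using F_free_digraphs_nonempty by (intro Max_in finite_arc_counts) auto
  then obtain D where "D \<in> F_free_digraphs n (n - 4)" and ex: "ex_F n (n - 4) = card (parcs D)"
    by blast
  then have D: "pair_fin_digraph D" "card (pverts D) = n" "F_free (n - 4) D"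
    by (simp_all add: F_free_digraphs_def)
  have "finite_unique_walks (parcs D) (n - 4) (pverts D)"
    using F_free_unique_walks[OF D(1,3)] assms by simp
  then have "2 * card (parcs D) + n + 8 \<le> n * n"
    using finite_unique_walks.card_arcs_le[of "parcs D" "n - 4" "pverts D"] D(2) assms by simp
  moreover have "card (parcs (levels_digraph n)) \<le> ex_F n (n - 4)"
    using card_arcs_le_ex_F[OF levels_digraph_fin F_free_levels_digraph[OF assms]]
    by (simp add: levels_digraph_def)
  ultimately have "2 * ex_F n (n - 4) + n + 8 = n * n"
    using card_levels_digraph[OF assms] ex by linarith
  then have "2 * real (ex_F n (n - 4)) + real n + 8 = real n * real n"
    by (metis of_nat_add of_nat_mult of_nat_numeral)
  then show ?thesis by (simp add: algebra_simps)
qed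

end
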